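(* Let $G$ be a finite weighted graph with vertex set $V(G)$, let $S\subset V(G)$ and $S^c=V(G)\setminus S$. Let $\mathcal{L}$ be the matrix obtained from the matrix of the Laplace operator $\Delta$ by replacing by zero the columns and rows corresponding to the set $S$. Then $S$ is a sampling set for all signals $f\in PW_\omega(G)$ with $\omega<\sigma$, where $\sigma$ is the smallest positive eigenvalue of $\mathcal{L}$.
   Context: In the finite graph $G$, $w(u,v)$ is the weight of the edge connecting $u$ and $v$, and the degree $\mu(v)$ is the sum of the weights of the edges incident to $v$. $L_2(G)$ is the Hilbert space of complex-valued functions on $V(G)$ with inner product $\langle f,g\rangle=\sum_{v\in V(G)}f(v)\overline{g(v)}\,\mu(v)$. The Laplace operator is $(\Delta f)(v)=\sum_{u\in V(G)}(f(v)-f(u))w(v,u)$, regarded as a positive-semidefinite self-adjoint operator; its rows and columns are indexed by the vertices. For $\omega>0$, $PW_\omega(G)$ is the linear span of the eigenfunctions of $\Delta$ whose eigenvalues are not greater than $\omega$. A set $S\subset V(G)$ is a sampling set for $PW_\omega(G)$ if there are constants $c,C>0$ with $c\|f\|^2\le\sum_{s\in S}|f(s)|^2\le C\|f\|^2$ for all $f\in PW_\omega(G)$.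
   Formalization: Adds that every connected component of G meets S (else its indicator lies in PW_ω and vanishes on S, e.g. K_2 with S empty, so the claim fails) and that all degrees are positive, so that L_2(G) is a Hilbert space. *)

theory Defs
  imports "HOL-Analysis.Analysis"
begin

text \<open>
  The vertex set is the universe of a finite type \<open>'v\<close>, functions on it are vectors in
  \<open>complex ^ 'v\<close>, and two vertices are adjacent iff the weight between them is positive.
  Loops are permitted: they contribute to the degree but not to the Laplace operator.
\<close>

definition weighted_graph :: "('v::finite \<Rightarrow> 'v \<Rightarrow> real) \<Rightarrow> bool" where
  "weighted_graph w \<longleftrightarrow> (\<forall>u v. w u v = w v u) \<and> (\<forall>u v. 0 \<le> w u v)"

definition edges :: "('v::finite \<Rightarrow> 'v \<Rightarrow> real) \<Rightarrow> ('v \<times> 'v) set" where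
  "edges w = {(u, v). 0 < w u v}"

definition vertex_degree :: "('v::finite \<Rightarrow> 'v \<Rightarrow> real) \<Rightarrow> 'v \<Rightarrow> real" where
  "vertex_degree w v = (\<Sum>u\<in>UNIV. w u v)"

definition L2_inner :: "('v::finite \<Rightarrow> 'v \<Rightarrow> real) \<Rightarrow> complex ^ 'v \<Rightarrow> complex ^ 'v \<Rightarrow> complex" where
  "L2_inner w f g = (\<Sum>v\<in>UNIV. f $ v * cnj (g $ v) * of_real (vertex_degree w v))"

definition L2_norm :: "('v::finite \<Rightarrow> 'v \<Rightarrow> real) \<Rightarrow> complex ^ 'v \<Rightarrow> real" where
  "L2_norm w f = sqrt (Re (L2_inner w f f))"

definition laplace :: "('v::finite \<Rightarrow> 'v \<Rightarrow> real) \<Rightarrow> complex ^ 'v \<Rightarrow> complex ^ 'v" where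
  "laplace w f = (\<chi> v. \<Sum>u\<in>UNIV. (f $ v - f $ u) * of_real (w v u))"

definition paley_wiener :: "('v::finite \<Rightarrow> 'v \<Rightarrow> real) \<Rightarrow> real \<Rightarrow> (complex ^ 'v) set" where
  "paley_wiener w \<omega> =
     vec.span {f. f \<noteq> 0 \<and> (\<exists>r::real. r \<le> \<omega> \<and> laplace w f = of_real r *s f)}"

definition sampling_set ::
    "('v::finite \<Rightarrow> 'v \<Rightarrow> real) \<Rightarrow> (complex ^ 'v) set \<Rightarrow> 'v set \<Rightarrow> bool" where
  "sampling_set w X S \<longleftrightarrow>
     (\<exists>c>0. \<exists>C>0. \<forall>f\<in>X.
        c * (L2_norm w f)\<^sup>2 \<le> (\<Sum>s\<in>S. (cmod (f $ s))\<^sup>2) \<and>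
        (\<Sum>s\<in>S. (cmod (f $ s))\<^sup>2) \<le> C * (L2_norm w f)\<^sup>2)"

definition zero_rows_cols :: "'v set \<Rightarrow> complex ^ ('v::finite) ^ 'v \<Rightarrow> complex ^ 'v ^ 'v" where
  "zero_rows_cols S A = (\<chi> i j. if i \<in> S \<or> j \<in> S then 0 else A $ i $ j)"

definition is_eigenvalue :: "complex ^ ('v::finite) ^ 'v \<Rightarrow> complex \<Rightarrow> bool" where
  "is_eigenvalue A k \<longleftrightarrow> (\<exists>x. x \<noteq> 0 \<and> A *v x = k *s x)"

definition is_smallest_pos_eigenvalue :: "complex ^ ('v::finite) ^ 'v \<Rightarrow> real \<Rightarrow> bool" where
  "is_smallest_pos_eigenvalue A \<sigma> \<longleftrightarrow>
     0 < \<sigma> \<and> is_eigenvalue A (of_real \<sigma>) \<and>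
     (\<forall>\<tau>>0. is_eigenvalue A (of_real \<tau>) \<longrightarrow> \<sigma> \<le> \<tau>)"

text \<open>
  Every connected component of the graph contains a vertex of \<open>S\<close>; for a connected graph
  this says that \<open>S\<close> is nonempty. If a component avoids \<open>S\<close>, its indicator function is an
  eigenfunction of \<open>laplace w\<close> with eigenvalue \<open>0\<close> that vanishes on \<open>S\<close>, so that \<open>S\<close> is not
  a sampling set for any \<open>\<omega> > 0\<close>.
\<close>

definition meets_all_components :: "('v::finite \<Rightarrow> 'v \<Rightarrow> real) \<Rightarrow> 'v set \<Rightarrow> bool" where
  "meets_all_components w S \<longleftrightarrow> (\<forall>v. \<exists>s\<in>S. (s, v) \<in> (edges w)\<^sup>*)"

end

theory Submission
  imports Defs
begin

text \<open>
  In finite dimension it is enough that a signal \<open>f\<close> of \<open>paley_wiener w \<omega>\<close> vanishing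
  on \<open>S\<close> is zero. The compression of the Laplace operator to the functions that vanish on \<open>S\<close>
  is self-adjoint, so its least Rayleigh quotient is an eigenvalue \<open>\<lambda>\<close> of the truncated matrix;
  \<open>\<lambda>\<close> is positive because a function of zero energy is constant on the components, all of which
  meet \<open>S\<close>. Hence \<open>\<sigma> \<le> \<lambda>\<close>. On the other hand, the Rayleigh quotient of any nonzero element of
  \<open>paley_wiener w \<omega>\<close> is at most \<open>\<omega> < \<sigma>\<close>.
  Self-adjointness and Rayleigh quotients refer to the real inner product \<open>\<bullet>\<close> of
  \<open>complex ^ 'v\<close>, which carries no degree weights.
\<close>

section \<open>Rayleigh quotients of symmetric operators\<close>

text \<open>Compactness of the unit sphere of \<open>V\<close> yields a minimizer \<open>g\<close>.
  Its residual \<open>T g - r *\<^sub>R g\<close> stays in \<open>V\<close> by invariance, so it is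
  an admissible direction of variation, and the first variation along it is twice its own squared
  norm.\<close>

lemma symmetric_min_rayleigh_eigenvector:
  fixes T :: "'a::euclidean_space \<Rightarrow> 'a"
  assumes lin: "linear T" and sym: "\<And>x y. T x \<bullet> y = x \<bullet> T y"
    and V: "subspace V" and inv: "\<And>x. x \<in> V \<Longrightarrow> T x \<in> V"
    and f: "f \<in> V" "f \<noteq> 0"
  obtains g r where "g \<in> V" "g \<noteq> 0" "T g = r *\<^sub>R g"
    "\<And>h. h \<in> V \<Longrightarrow> r * (h \<bullet> h) \<le> T h \<bullet> h"
proof -
  define K where "K = V \<inter> sphere 0 1"
  have "compact K"
    unfolding K_def using closed_subspace[OF V] by (simp add: closed_Int_compact)
  moreover have "f /\<^sub>R norm f \<in> K"
    using f V by (simp add: K_def subspace_scale)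
  moreover have "continuous_on K (\<lambda>x. T x \<bullet> x)"
    using lin by (intro continuous_intros linear_continuous_on) (simp add: linear_conv_bounded_linear)
  ultimately obtain g where g: "g \<in> K" and gmin: "\<And>x. x \<in> K \<Longrightarrow> T g \<bullet> g \<le> T x \<bullet> x"
    using continuous_attains_inf[of K "\<lambda>x. T x \<bullet> x"] by (metis empty_iff)
  define r where "r = T g \<bullet> g"
  have gV: "g \<in> V" and gg: "g \<bullet> g = 1"
    using g by (auto simp: K_def norm_eq_1)
  have le: "r * (h \<bullet> h) \<le> T h \<bullet> h" if h: "h \<in> V" for h
  proof (cases "h = 0")
    case True
    then show ?thesis using lin by (simp add: linear_0)
  next
    case False
    have "r \<le> T (h /\<^sub>R norm h) \<bullet> (h /\<^sub>R norm h)"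
      unfolding r_def using False h V by (intro gmin) (simp add: K_def subspace_scale)
    also have "\<dots> = (T h \<bullet> h) / (h \<bullet> h)"
      using False lin by (simp add: linear_scale dot_square_norm power2_eq_square divide_simps)
    finally show ?thesis using False by (simp add: field_simps)
  qed
  define h where "h = T g - r *\<^sub>R g"
  have hV: "h \<in> V"
    unfolding h_def by (intro subspace_diff[OF V] subspace_scale[OF V] inv gV)
  define b where "b = T h \<bullet> h - r * (h \<bullet> h)"
  \<comment> \<open>Expand the inequality \<open>le\<close> at \<open>g + t *\<^sub>R h\<close>; its first-order term must vanish.\<close>
  have quad: "0 \<le> 2 * t * (h \<bullet> h) + t\<^sup>2 * b" for t
  proof -
    have "0 \<le> T (g + t *\<^sub>R h) \<bullet> (g + t *\<^sub>R h) - r * ((g + t *\<^sub>R h) \<bullet> (g + t *\<^sub>R h))"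
      using le[of "g + t *\<^sub>R h"] gV hV V by (simp add: subspace_add subspace_scale)
    also have "\<dots> = (T g \<bullet> g - r * (g \<bullet> g)) + 2 * t * (T g \<bullet> h - r * (g \<bullet> h)) + t\<^sup>2 * b"
      using sym[of h g] lin
      by (simp add: linear_add linear_scale b_def inner_add_left inner_add_right
          inner_commute power2_eq_square algebra_simps)
    also have "T g \<bullet> g - r * (g \<bullet> g) = 0" by (simp add: gg r_def)
    also have "T g \<bullet> h - r * (g \<bullet> h) = h \<bullet> h"
      by (simp add: h_def inner_diff_left)
    finally show ?thesis by simp
  qed
  have b0: "0 \<le> b" using le[OF hV] by (simp add: b_def)
  have "h \<bullet> h \<le> 0"
  proof -
    \<comment> \<open>This \<open>t\<close> makes the negative linear term outweigh the quadratic
      one. The denominator is \<open>1 + b\<close> rather than \<open>b\<close> because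
      \<open>b\<close> may be zero.\<close>
    have "0 \<le> 2 * (- ((h \<bullet> h) / (1 + b))) * (h \<bullet> h) + (- ((h \<bullet> h) / (1 + b)))\<^sup>2 * b"
      by (rule quad)
    also have "\<dots> = - (h \<bullet> h)\<^sup>2 * (2 + b) / (1 + b)\<^sup>2"
      using b0 by (simp add: divide_simps) (simp add: power2_eq_square algebra_simps)
    finally have "(h \<bullet> h)\<^sup>2 * (2 + b) \<le> 0"
      using b0 by (simp add: divide_le_0_iff zero_le_divide_iff)
    then show ?thesis using b0 by (simp add: mult_le_0_iff)
  qed
  then have "h = 0" by (metis inner_gt_zero_iff not_le)
  then have "T g = r *\<^sub>R g" by (simp add: h_def)
  moreover have "g \<noteq> 0" using gg by auto
  ultimately show ?thesis using that gV le by blast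
qed

lemma symmetric_eigenvectors_orthogonal:
  fixes T :: "'a::real_inner \<Rightarrow> 'a"
  assumes "\<And>x y. T x \<bullet> y = x \<bullet> T y" "T x = r *\<^sub>R x" "T y = s *\<^sub>R y" "r \<noteq> s"
  shows "x \<bullet> y = 0"
  using assms(1)[of x y] assms(2-4) by simp

text \<open>Indexing the summands by their eigenvalues makes them pairwise orthogonal. All cross
  terms vanish, and the two sides compare term by term.\<close>

lemma symmetric_rayleigh_sum_eigenvectors_le:
  fixes T :: "'a::real_inner \<Rightarrow> 'a"
  assumes lin: "linear T" and sym: "\<And>x y. T x \<bullet> y = x \<bullet> T y"
    and fin: "finite R" and R: "\<And>r. r \<in> R \<Longrightarrow> r \<le> \<omega>"
    and eig: "\<And>r. r \<in> R \<Longrightarrow> T (g r) = r *\<^sub>R g r"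
  shows "T (\<Sum>r\<in>R. g r) \<bullet> (\<Sum>r\<in>R. g r) \<le> \<omega> * ((\<Sum>r\<in>R. g r) \<bullet> (\<Sum>r\<in>R. g r))"
proof -
  have orth: "g r \<bullet> (\<Sum>s\<in>R. g s) = g r \<bullet> g r" if "r \<in> R" for r
  proof -
    have "(\<Sum>s\<in>R. g r \<bullet> g s) = (\<Sum>s\<in>R. if s = r then g r \<bullet> g r else 0)"
      using that by (intro sum.cong refl)
        (auto intro: symmetric_eigenvectors_orthogonal[OF sym eig eig])
    then show ?thesis using that fin by (simp add: inner_sum_right)
  qed
  have "T (\<Sum>r\<in>R. g r) \<bullet> (\<Sum>r\<in>R. g r) = (\<Sum>r\<in>R. r * (g r \<bullet> g r))"
    using lin eig orth by (simp add: linear_sum inner_sum_left)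
  also have "\<dots> \<le> (\<Sum>r\<in>R. \<omega> * (g r \<bullet> g r))"
    using R by (intro sum_mono mult_right_mono) auto
  also have "\<dots> = \<omega> * ((\<Sum>r\<in>R. g r) \<bullet> (\<Sum>r\<in>R. g r))"
    using orth by (simp add: inner_sum_left[of g] sum_distrib_left)
  finally show ?thesis .
qed

section \<open>The Laplace operator and its energy\<close>

lemma of_real_smult_eq_scaleR: "of_real r *s x = r *\<^sub>R (x :: complex ^ 'n)"
  by (simp add: vec_eq_iff) (simp add: scaleR_conv_of_real)

text \<open>Signals form a complex span, whereas closedness and the lower bound for injective maps
  are stated for real subspaces.\<close>

lemma span_subspace_real: "subspace (vec.span X :: (complex ^ 'n::finite) set)"
  unfolding subspace_def
  by (auto simp: vec.span_zero vec.span_add vec.span_scale simp flip: of_real_smult_eq_scaleR)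

lemma laplace_clinear: "Vector_Spaces.linear (*s) (*s) (laplace w)"
  by unfold_locales
    (simp_all add: laplace_def vec_eq_iff sum.distrib[symmetric] sum_distrib_left algebra_simps)

lemma laplace_linear: "linear (laplace w)"
  by (rule linearI)
    (simp_all add: laplace_def vec_eq_iff sum.distrib[symmetric] scaleR_sum_right algebra_simps)

text \<open>Summation by parts: exchanging the two vertices and using the symmetry of
  \<open>w\<close> gives a second form of the same sum, and the two are averaged. Symmetry,
  positivity and the kernel are all read off from this form.\<close>

lemma laplace_inner_eq_energy:
  assumes "weighted_graph w"
  shows "laplace w f \<bullet> g =
    (\<Sum>v\<in>UNIV. \<Sum>u\<in>UNIV. w v u * ((f $ v - f $ u) \<bullet> (g $ v - g $ u))) / 2"
proof -
  define A where "A = (\<Sum>v\<in>UNIV. \<Sum>u\<in>UNIV. w v u * ((f $ v - f $ u) \<bullet> g $ v))"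
  have sym: "w u v = w v u" for u v using assms by (auto simp: weighted_graph_def)
  have l: "laplace w f \<bullet> g = A"
    unfolding A_def inner_vec_def laplace_def
    by (simp add: inner_sum_left mult.commute[of _ "of_real _"] flip: scaleR_conv_of_real)
  have "A = (\<Sum>v\<in>UNIV. \<Sum>u\<in>UNIV. w u v * ((f $ u - f $ v) \<bullet> g $ u))"
    unfolding A_def by (rule sum.swap)
  also have "\<dots> = - (\<Sum>v\<in>UNIV. \<Sum>u\<in>UNIV. w v u * ((f $ v - f $ u) \<bullet> g $ u))"
    unfolding sum_negf[symmetric]
    by (intro sum.cong refl) (subst sym, simp add: inner_diff_left right_diff_distrib)
  finally have "A + A = (\<Sum>v\<in>UNIV. \<Sum>u\<in>UNIV. w v u * ((f $ v - f $ u) \<bullet> (g $ v - g $ u)))"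
    unfolding A_def by (simp add: inner_diff_right right_diff_distrib sum_subtractf)
  then show ?thesis using l by simp
qed

lemma laplace_symmetric:
  assumes "weighted_graph w"
  shows "laplace w f \<bullet> g = f \<bullet> laplace w g"
  unfolding inner_commute[of f] laplace_inner_eq_energy[OF assms]
  by (simp add: inner_commute)

lemma laplace_energy_nonneg:
  assumes "weighted_graph w"
  shows "0 \<le> laplace w f \<bullet> f"
  using assms unfolding laplace_inner_eq_energy[OF assms]
  by (auto intro!: sum_nonneg simp: weighted_graph_def)

text \<open>Every term of the energy is nonnegative, so zero energy forces equal values across each
  edge, and then along each path.\<close>

lemma laplace_zero_energy_const_on_components:
  assumes w: "weighted_graph w" and 0: "laplace w f \<bullet> f = 0" and uv: "(u, v) \<in> (edges w)\<^sup>*"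
  shows "f $ u = f $ v"
  using uv
proof induction
  case (step x y)
  let ?e = "\<lambda>v u. w v u * ((f $ v - f $ u) \<bullet> (f $ v - f $ u))"
  have nn: "0 \<le> ?e v u" for v u using w by (auto simp: weighted_graph_def)
  have "(\<Sum>v\<in>UNIV. \<Sum>u\<in>UNIV. ?e v u) = 0"
    using 0 by (simp add: laplace_inner_eq_energy[OF w])
  then have "?e x y = 0"
    by (simp add: sum_nonneg_eq_0_iff sum_nonneg nn del: mult_eq_0_iff)
  then show ?case using step by (simp add: edges_def)
qed simp

lemma paley_wiener_rayleigh_le:
  assumes w: "weighted_graph w" and f: "f \<in> paley_wiener w \<omega>"
  shows "laplace w f \<bullet> f \<le> \<omega> * (f \<bullet> f)"
proof -
  \<comment> \<open>The spanning eigenfunctions are collected into one summand per eigenvalue;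
    several independent ones for the same eigenvalue need not be orthogonal.\<close>
  have "\<exists>R g. finite R \<and> (\<forall>r\<in>R. r \<le> \<omega> \<and> laplace w (g r) = r *\<^sub>R g r) \<and> f = (\<Sum>r\<in>R. g r)"
    using f unfolding paley_wiener_def
  proof (induction rule: vec.span_induct_alt)
    case base
    show ?case by (rule exI[of _ "{}"]) simp
  next
    case (step c x y)
    obtain r0 where r0: "r0 \<le> \<omega>" "laplace w x = r0 *\<^sub>R x"
      using step.hyps by (auto simp: of_real_smult_eq_scaleR)
    obtain R g where R: "finite R" "\<forall>r\<in>R. r \<le> \<omega> \<and> laplace w (g r) = r *\<^sub>R g r"
      and y: "y = (\<Sum>r\<in>R. g r)" using step.IH by blast
    interpret lap: Vector_Spaces.linear "(*s)" "(*s)" "laplace w" by (rule laplace_clinear)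
    \<comment> \<open>The new term joins the summand for \<open>r0\<close> if there is one and
      otherwise starts it. The guard is needed because \<open>g\<close> is arbitrary outside
      \<open>R\<close>.\<close>
    define g' where "g' r = (if r \<in> R then g r else 0) + (if r = r0 then c *s x else 0)" for r
    have "laplace w (g' r) = r *\<^sub>R g' r" if "r \<in> insert r0 R" for r
      using that R r0
      by (auto simp: g'_def lap.add lap.scale lap.zero scaleR_add_right
          simp flip: of_real_smult_eq_scaleR)
    moreover have "(\<Sum>r\<in>insert r0 R. g' r) = c *s x + y"
      using R(1) unfolding g'_def y sum.distrib
      by (subst add.commute, intro arg_cong2[of _ _ _ _ "(+)"])
        (auto simp: sum.delta intro!: sum.mono_neutral_cong_right)
    ultimately show ?case
      using R r0(1) by (intro exI[of _ "insert r0 R"] exI[of _ g']) auto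
  qed
  then show ?thesis
    using symmetric_rayleigh_sum_eigenvectors_le[OF laplace_linear laplace_symmetric[OF w]] by metis
qed

section \<open>Restriction to vertex sets and the truncated matrix\<close>

text \<open>An orthogonal coordinate projection, used twice: on \<open>- S\<close> it compresses the
  Laplace operator, on \<open>S\<close> it is the sampling map.\<close>

definition restrict_vec :: "'v set \<Rightarrow> complex ^ 'v::finite \<Rightarrow> complex ^ 'v" where
  "restrict_vec A f = (\<chi> v. if v \<in> A then f $ v else 0)"

lemma restrict_vec_linear: "linear (restrict_vec A)"
  by (rule linearI) (auto simp: restrict_vec_def vec_eq_iff)

lemma restrict_vec_symmetric: "restrict_vec A f \<bullet> g = f \<bullet> restrict_vec A g"
  by (auto simp: restrict_vec_def inner_vec_def intro!: sum.cong)

lemma norm_restrict_vec: "(norm (restrict_vec A f))\<^sup>2 = (\<Sum>v\<in>A. (cmod (f $ v))\<^sup>2)"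
proof -
  have "(norm (restrict_vec A f))\<^sup>2 = (\<Sum>v\<in>UNIV. if v \<in> A then (cmod (f $ v))\<^sup>2 else 0)"
    unfolding norm_vec_def L2_set_def
    by (subst real_sqrt_pow2) (auto simp: restrict_vec_def intro!: sum_nonneg sum.cong)
  then show ?thesis by (simp add: sum.If_cases)
qed

lemma zero_rows_cols_mult_vec:
  assumes "Vector_Spaces.linear (*s) (*s) T"
  shows "zero_rows_cols S (matrix T) *v f = restrict_vec (- S) (T (restrict_vec (- S) f))"
  by (subst matrix_works[OF assms, symmetric])
    (auto simp: vec_eq_iff zero_rows_cols_def restrict_vec_def matrix_vector_mult_def
        intro!: sum.cong)

lemma paley_wiener_vanishing_on_sampling_eq_0:
  assumes w: "weighted_graph w" and S: "meets_all_components w S"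
    and \<sigma>: "is_smallest_pos_eigenvalue (zero_rows_cols S (matrix (laplace w))) \<sigma>" "\<omega> < \<sigma>"
    and f: "f \<in> paley_wiener w \<omega>" "restrict_vec S f = 0"
  shows "f = 0"
proof (rule ccontr)
  assume "f \<noteq> 0"
  define V where "V = {g :: complex ^ 'a. \<forall>s\<in>S. g $ s = 0}"
  define T where "T = restrict_vec (- S) \<circ> laplace w \<circ> restrict_vec (- S)"
  have "subspace V" by (auto simp: V_def subspace_def)
  moreover have "linear T"
    unfolding T_def by (intro linear_compose restrict_vec_linear laplace_linear)
  moreover have "T x \<bullet> y = x \<bullet> T y" for x y
    by (simp add: T_def restrict_vec_symmetric laplace_symmetric[OF w])
  moreover have "T x \<in> V" for x by (simp add: T_def V_def restrict_vec_def)
  \<comment> \<open>The signal \<open>f\<close> first shows that \<open>V\<close> is nonzero, so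
    that a minimizer exists; at the end it is itself tested against the minimum.\<close>
  moreover have fV: "f \<in> V"
    using f(2) by (auto simp: V_def restrict_vec_def vec_eq_iff split: if_splits)
  ultimately obtain g r where g: "g \<in> V" "g \<noteq> 0" "T g = r *\<^sub>R g"
    and min: "\<And>h. h \<in> V \<Longrightarrow> r * (h \<bullet> h) \<le> T h \<bullet> h"
    using symmetric_min_rayleigh_eigenvector[of T V f] \<open>f \<noteq> 0\<close> by blast
  have restr: "restrict_vec (- S) h = h" if "h \<in> V" for h
    using that by (auto simp: V_def restrict_vec_def vec_eq_iff)
  have energy: "T h \<bullet> h = laplace w h \<bullet> h" if "h \<in> V" for h
    by (simp add: T_def restrict_vec_symmetric restr[OF that])
  have rg: "laplace w g \<bullet> g = r * (g \<bullet> g)"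
    using energy[OF g(1)] g(3) by simp
  have "r \<noteq> 0"
  proof
    assume "r = 0"
    then have const: "g $ s = g $ v" if "(s, v) \<in> (edges w)\<^sup>*" for s v
      using rg by (intro laplace_zero_energy_const_on_components[OF w _ that]) simp
    have "g $ v = 0" for v
    proof -
      obtain s where "s \<in> S" "(s, v) \<in> (edges w)\<^sup>*"
        using S by (auto simp: meets_all_components_def)
      then show ?thesis using g(1) const[of s v] by (simp add: V_def)
    qed
    then show False using g(2) by (simp add: vec_eq_iff)
  qed
  moreover have "0 \<le> r"
    using laplace_energy_nonneg[OF w, of g] g(2) inner_gt_zero_iff[of g]
    by (simp add: rg zero_le_mult_iff not_le[symmetric])
  moreover have "is_eigenvalue (zero_rows_cols S (matrix (laplace w))) (of_real r)"
    unfolding is_eigenvalue_def zero_rows_cols_mult_vec[OF laplace_clinear] of_real_smult_eq_scaleR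
    using g by (auto simp: T_def)
  ultimately have "\<sigma> \<le> r"
    using \<sigma>(1) by (auto simp: is_smallest_pos_eigenvalue_def)
  have "r * (f \<bullet> f) \<le> \<omega> * (f \<bullet> f)"
    using min[OF fV] energy[OF fV] paley_wiener_rayleigh_le[OF w f(1)] by simp
  then have "r \<le> \<omega>" using \<open>f \<noteq> 0\<close> by simp
  with \<open>\<sigma> \<le> r\<close> \<sigma>(2) show False by simp
qed

section \<open>Comparison of norms and the sampling inequality\<close>

lemma L2_norm_sq:
  assumes "\<And>v. 0 \<le> vertex_degree w v"
  shows "(L2_norm w f)\<^sup>2 = (\<Sum>v\<in>UNIV. vertex_degree w v * (cmod (f $ v))\<^sup>2)"
proof -
  have "L2_inner w f f = of_real (\<Sum>v\<in>UNIV. vertex_degree w v * (cmod (f $ v))\<^sup>2)"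
    by (simp add: L2_inner_def complex_norm_square mult.commute del: of_real_power)
  moreover have "0 \<le> (\<Sum>v\<in>UNIV. vertex_degree w v * (cmod (f $ v))\<^sup>2)"
    using assms by (intro sum_nonneg) simp
  ultimately show ?thesis by (simp add: L2_norm_def)
qed

lemma norm_vec_sq: "(norm (f :: complex ^ 'n))\<^sup>2 = (\<Sum>v\<in>UNIV. (cmod (f $ v))\<^sup>2)"
  by (simp add: norm_vec_def L2_set_def sum_nonneg)

text \<open>The least and the greatest of the finitely many positive degrees serve as
  constants.\<close>

lemma L2_norm_equivalent:
  fixes w :: "'v::finite \<Rightarrow> 'v \<Rightarrow> real"
  assumes "\<And>v. 0 < vertex_degree w v"
  obtains m M where "0 < m" "0 < M"
    "\<And>f. m * (norm f)\<^sup>2 \<le> (L2_norm w f)\<^sup>2" "\<And>f. (L2_norm w f)\<^sup>2 \<le> M * (norm f)\<^sup>2"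
proof
  let ?m = "Min (range (vertex_degree w))" and ?M = "Max (range (vertex_degree w))"
  show "0 < ?m" using assms by simp
  show "0 < ?M" using assms by (simp add: Max_gr_iff)
  note sq = L2_norm_sq[OF less_imp_le[OF assms]]
  show "?m * (norm f)\<^sup>2 \<le> (L2_norm w f)\<^sup>2" for f
    unfolding sq norm_vec_sq sum_distrib_left by (intro sum_mono mult_right_mono) simp_all
  show "(L2_norm w f)\<^sup>2 \<le> ?M * (norm f)\<^sup>2" for f
    unfolding sq norm_vec_sq sum_distrib_left by (intro sum_mono mult_right_mono) simp_all
qed

theorem mainTheorem2:
  fixes w :: "'v::finite \<Rightarrow> 'v \<Rightarrow> real"
    and S :: "'v set"
    and \<omega> \<sigma> :: real
  assumes "weighted_graph w"
    and "\<forall>v. 0 < vertex_degree w v"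
    and "meets_all_components w S"
    and "is_smallest_pos_eigenvalue (zero_rows_cols S (matrix (laplace w))) \<sigma>"
    and "0 < \<omega>" and "\<omega> < \<sigma>"
  shows "sampling_set w (paley_wiener w \<omega>) S"
proof -
  have sub: "subspace (paley_wiener w \<omega>)"
    unfolding paley_wiener_def by (rule span_subspace_real)
  \<comment> \<open>The sampling map has trivial kernel on the signal space, and an injective linear
    map on a finite-dimensional space is bounded below.\<close>
  obtain e where "0 < e"
    and e: "\<And>f. f \<in> paley_wiener w \<omega> \<Longrightarrow> e * norm f \<le> norm (restrict_vec S f)"
    using injective_imp_isometric[OF closed_subspace[OF sub] sub, of "restrict_vec S"]
      paley_wiener_vanishing_on_sampling_eq_0[OF assms(1,3,4,6)] restrict_vec_linear
    unfolding linear_conv_bounded_linear by metis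
  obtain m M where m: "0 < m" "0 < M"
    "\<And>f. m * (norm f)\<^sup>2 \<le> (L2_norm w f)\<^sup>2" "\<And>f. (L2_norm w f)\<^sup>2 \<le> M * (norm f)\<^sup>2"
    using L2_norm_equivalent[of w] assms(2) by metis
  show ?thesis
    unfolding sampling_set_def
  proof (intro exI conjI ballI)
    \<comment> \<open>Squaring the bound with \<open>e\<close> and dividing by \<open>M\<close>
      passes to the weighted norm. The upper bound only enlarges the sum over \<open>S\<close> to
      all vertices.\<close>
    show "0 < e\<^sup>2 / M" "0 < 1 / m" using \<open>0 < e\<close> m by simp_all
    fix f assume f: "f \<in> paley_wiener w \<omega>"
    have "e\<^sup>2 / M * (L2_norm w f)\<^sup>2 \<le> e\<^sup>2 / M * (M * (norm f)\<^sup>2)"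
      using m by (intro mult_left_mono) auto
    also have "\<dots> = (e * norm f)\<^sup>2" using m by (simp add: power_mult_distrib)
    also have "\<dots> \<le> (norm (restrict_vec S f))\<^sup>2"
      using e[OF f] \<open>0 < e\<close> by (intro power_mono) auto
    finally show "e\<^sup>2 / M * (L2_norm w f)\<^sup>2 \<le> (\<Sum>s\<in>S. (cmod (f $ s))\<^sup>2)"
      by (simp add: norm_restrict_vec)
    have "(\<Sum>s\<in>S. (cmod (f $ s))\<^sup>2) \<le> (norm f)\<^sup>2"
      unfolding norm_vec_sq by (intro sum_mono2) auto
    also have "\<dots> \<le> 1 / m * (L2_norm w f)\<^sup>2"
      using m(1) m(3)[of f] by (simp add: field_simps)
    finally show "(\<Sum>s\<in>S. (cmod (f $ s))\<^sup>2) \<le> 1 / m * (L2_norm w f)\<^sup>2" .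
  qed
qed

end
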